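(* Let $p(D)\in\mathbb{C}[D]$, let $f\in M_{\mathrm{tors}}$, and let $q(D)$ be a minimal annihilator of $f$. Let $F\subset C^\infty(\mathbb{R})$ be a minimal trial space for $p(D)y=f$, and let \[ V_q=\ker\bigl(p(D)q(D)\bigr)\big/\ker p(D). \] Then $F\subset\ker\bigl(p(D)q(D)\bigr)$, and the natural quotient projection $\pi:\ker\bigl(p(D)q(D)\bigr)\to V_q$ restricted to $F$, \[ \pi|_F:F\to V_q, \] is an isomorphism of vector spaces. Consequently, $\dim F=\deg q(D)$.
   Context: $C^\infty(\mathbb{R})$ is the complex vector space of infinitely differentiable functions $\mathbb{R}\to\mathbb{C}$, and $D=\frac{d}{dx}$. A polynomial $p(D)\in\mathbb{C}[D]$ acts on $C^\infty(\mathbb{R})$ as the differential operator $p\left(\frac{d}{dx}\right)$; $\ker p(D)$ is its kernel in $C^\infty(\mathbb{R})$. The torsion submodule is \[ M_{\mathrm{tors}}=\{f\in C^\infty(\mathbb{R}) : \exists\, p(D)\in\mathbb{C}[D]\setminus\{0\} \text{ with } p(D)f=0\}. \] An annihilator of $f$ is a nonzero $q(D)\in\mathbb{C}[D]$ with $q(D)f=0$; it is minimal if $\deg q(D)\le\deg\tilde q(D)$ for every nonzero $\tilde q(D)\in\mathbb{C}[D]$ with $\tilde q(D)f=0$. A minimal trial space for $p(D)y=f$ is a finite-dimensional $\mathbb{C}$-subspace $F\subset C^\infty(\mathbb{R})$ with $f\in F$ such that: (1) $F$ is invariant under $D$ (hence under $p(D)$); (2) the restriction $p(D)|_F:F\to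 F$ is an automorphism; (3) $F$ is minimal in dimension, i.e. of smallest dimension among the finite-dimensional subspaces containing $f$ that satisfy (1), (2) and (4); (4) $\ker p(D)\cap F=\{0\}$. *)

theory Defs
  imports
    "HOL-Analysis.Analysis"
    "HOL-Library.Function_Algebras"
    "HOL-Computational_Algebra.Polynomial"
begin

definition fscale :: "complex \<Rightarrow> (real \<Rightarrow> complex) \<Rightarrow> (real \<Rightarrow> complex)" where
  "fscale c f = (\<lambda>x. c * f x)"

(* Dimensions and spans below are over the complex numbers, through this
   interpretation; the addition is that of HOL-Library.Function_Algebras. *)
global_interpretation cfun: vector_space fscale
  by unfold_locales (auto simp: fscale_def fun_eq_iff algebra_simps)


definition Dop :: "(real \<Rightarrow> complex) \<Rightarrow> (real \<Rightarrow> complex)" where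
  "Dop f = (\<lambda>x. vector_derivative f (at x))"

definition Cinf :: "(real \<Rightarrow> complex) set" where
  "Cinf = {f. \<forall>n x. (Dop ^^ n) f differentiable (at x)}"

(* The operator p(D); it is only meaningful on Cinf. *)
definition pD :: "complex poly \<Rightarrow> (real \<Rightarrow> complex) \<Rightarrow> (real \<Rightarrow> complex)" where
  "pD p f = (\<Sum>i\<le>degree p. fscale (coeff p i) ((Dop ^^ i) f))"

definition kerD :: "complex poly \<Rightarrow> (real \<Rightarrow> complex) set" where
  "kerD p = {f \<in> Cinf. pD p f = 0}"

definition M_tors :: "(real \<Rightarrow> complex) set" where
  "M_tors = {f \<in> Cinf. \<exists>p. p \<noteq> 0 \<and> pD p f = 0}"

definition annihilator :: "complex poly \<Rightarrow> (real \<Rightarrow> complex) \<Rightarrow> bool" where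
  "annihilator q f \<longleftrightarrow> q \<noteq> 0 \<and> pD q f = 0"

definition minimal_annihilator :: "complex poly \<Rightarrow> (real \<Rightarrow> complex) \<Rightarrow> bool" where
  "minimal_annihilator q f \<longleftrightarrow>
     annihilator q f \<and> (\<forall>r. annihilator r f \<longrightarrow> degree q \<le> degree r)"


(* An isomorphism h : V \<rightarrow> W of complex vector spaces with carriers V and W and with
   the given additions and scalar multiplications. *)
definition vs_iso ::
  "('a \<Rightarrow> 'a \<Rightarrow> 'a) \<Rightarrow> (complex \<Rightarrow> 'a \<Rightarrow> 'a) \<Rightarrow> 'a set \<Rightarrow>
   ('b \<Rightarrow> 'b \<Rightarrow> 'b) \<Rightarrow> (complex \<Rightarrow> 'b \<Rightarrow> 'b) \<Rightarrow> 'b set \<Rightarrow> ('a \<Rightarrow> 'b) \<Rightarrow> bool" where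
  "vs_iso addV scaleV V addW scaleW W h \<longleftrightarrow>
     bij_betw h V W \<and>
     (\<forall>x\<in>V. \<forall>y\<in>V. h (addV x y) = addW (h x) (h y)) \<and>
     (\<forall>c. \<forall>x\<in>V. h (scaleV c x) = scaleW c (h x))"

definition fin_dim_subspace :: "(real \<Rightarrow> complex) set \<Rightarrow> bool" where
  "fin_dim_subspace F \<longleftrightarrow>
     cfun.subspace F \<and> F \<subseteq> Cinf \<and> (\<exists>B. finite B \<and> F = cfun.span B)"

(* All the conditions on a minimal trial space except minimality of the dimension. *)
definition trial_space ::
  "complex poly \<Rightarrow> (real \<Rightarrow> complex) \<Rightarrow> (real \<Rightarrow> complex) set \<Rightarrow> bool" where
  "trial_space p f F \<longleftrightarrow>
     fin_dim_subspace F \<and> f \<in> F \<and>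
     Dop ` F \<subseteq> F \<and>
     vs_iso (+) fscale F (+) fscale F (pD p) \<and>
     kerD p \<inter> F = {0}"

definition minimal_trial_space ::
  "complex poly \<Rightarrow> (real \<Rightarrow> complex) \<Rightarrow> (real \<Rightarrow> complex) set \<Rightarrow> bool" where
  "minimal_trial_space p f F \<longleftrightarrow>
     trial_space p f F \<and> (\<forall>G. trial_space p f G \<longrightarrow> cfun.dim F \<le> cfun.dim G)"


(* The quotient space U / W of subspaces W \<subseteq> U: the carrier consists of the cosets
   g + W with g in U, and the operations act on representatives. *)
definition coset_rel ::
  "(real \<Rightarrow> complex) set \<Rightarrow> (real \<Rightarrow> complex) set \<Rightarrow> ((real \<Rightarrow> complex) \<times> (real \<Rightarrow> complex)) set" where
  "coset_rel U W = {(g, h). g \<in> U \<and> h \<in> U \<and> g - h \<in> W}"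

definition quot_space ::
  "(real \<Rightarrow> complex) set \<Rightarrow> (real \<Rightarrow> complex) set \<Rightarrow> (real \<Rightarrow> complex) set set" where
  "quot_space U W = U // coset_rel U W"

definition quot_proj ::
  "(real \<Rightarrow> complex) set \<Rightarrow> (real \<Rightarrow> complex) set \<Rightarrow> (real \<Rightarrow> complex) \<Rightarrow> (real \<Rightarrow> complex) set" where
  "quot_proj U W = Equiv_Relations.proj (coset_rel U W)"

definition quot_add ::
  "(real \<Rightarrow> complex) set \<Rightarrow> (real \<Rightarrow> complex) set \<Rightarrow>
   (real \<Rightarrow> complex) set \<Rightarrow> (real \<Rightarrow> complex) set \<Rightarrow> (real \<Rightarrow> complex) set" where
  "quot_add U W A B = (\<Union>g\<in>A. \<Union>h\<in>B. quot_proj U W (g + h))"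

definition quot_scale ::
  "(real \<Rightarrow> complex) set \<Rightarrow> (real \<Rightarrow> complex) set \<Rightarrow>
   complex \<Rightarrow> (real \<Rightarrow> complex) set \<Rightarrow> (real \<Rightarrow> complex) set" where
  "quot_scale U W c A = (\<Union>g\<in>A. quot_proj U W (fscale c g))"

lemma equiv_coset_rel:
  assumes "cfun.subspace W"
  shows "equiv U (coset_rel U W)"
proof (rule equivI)
  show "coset_rel U W \<subseteq> U \<times> U"
    by (auto simp: coset_rel_def)
  show "refl_on U (coset_rel U W)"
    using cfun.subspace_0[OF assms] by (auto simp: refl_on_def coset_rel_def)
  show "sym (coset_rel U W)"
    using cfun.subspace_neg[OF assms] by (fastforce simp: sym_def coset_rel_def)
  show "trans (coset_rel U W)"
  proof (rule transI)
    fix x y z assume "(x, y) \<in> coset_rel U W" "(y, z) \<in> coset_rel U W"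
    moreover have "x - z = (x - y) + (y - z)" by simp
    ultimately show "(x, z) \<in> coset_rel U W"
      using cfun.subspace_add[OF assms, of "x - y" "y - z"] by (simp add: coset_rel_def)
  qed
qed

lemma quot_proj_eq_iff:
  assumes "cfun.subspace W" "g \<in> U" "h \<in> U"
  shows "quot_proj U W g = quot_proj U W h \<longleftrightarrow> g - h \<in> W"
  using proj_iff[OF equiv_coset_rel[OF assms(1)], of g h U] assms(2,3)
  by (simp add: quot_proj_def coset_rel_def)

(* The operations on U / W are independent of the representatives. *)

lemma quot_add_proj:
  assumes "cfun.subspace U" "cfun.subspace W" "g \<in> U" "h \<in> U"
  shows "quot_add U W (quot_proj U W g) (quot_proj U W h) = quot_proj U W (g + h)"
proof -
  have "quot_proj U W (g' + h') = quot_proj U W (g + h)"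
    if "g' \<in> quot_proj U W g" "h' \<in> quot_proj U W h" for g' h'
  proof -
    have *: "g' \<in> U" "h' \<in> U" "g - g' \<in> W" "h - h' \<in> W"
      using that by (auto simp: quot_proj_def Equiv_Relations.proj_def coset_rel_def)
    have "(g + h) - (g' + h') = (g - g') + (h - h')" by simp
    then have "(g + h) - (g' + h') \<in> W"
      using cfun.subspace_add[OF assms(2) *(3,4)] by metis
    then show ?thesis
      using quot_proj_eq_iff[OF assms(2), of "g + h" U "g' + h'"] * assms
      by (simp add: cfun.subspace_add)
  qed
  moreover have "g \<in> quot_proj U W g" "h \<in> quot_proj U W h"
    using equiv_class_self[OF equiv_coset_rel[OF assms(2)]] assms(3,4)
    by (auto simp: quot_proj_def Equiv_Relations.proj_def)
  ultimately show ?thesis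
    unfolding quot_add_def by blast
qed

lemma quot_scale_proj:
  assumes "cfun.subspace U" "cfun.subspace W" "g \<in> U"
  shows "quot_scale U W c (quot_proj U W g) = quot_proj U W (fscale c g)"
proof -
  have "quot_proj U W (fscale c g') = quot_proj U W (fscale c g)"
    if "g' \<in> quot_proj U W g" for g'
  proof -
    have *: "g' \<in> U" "g - g' \<in> W"
      using that by (auto simp: quot_proj_def Equiv_Relations.proj_def coset_rel_def)
    have "fscale c g - fscale c g' \<in> W"
      using cfun.subspace_scale[OF assms(2) *(2), of c] by (simp add: cfun.scale_right_diff_distrib)
    then show ?thesis
      using quot_proj_eq_iff[OF assms(2), of "fscale c g" U "fscale c g'"] * assms
      by (simp add: cfun.subspace_scale)
  qed
  moreover have "g \<in> quot_proj U W g"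
    using equiv_class_self[OF equiv_coset_rel[OF assms(2)]] assms(3)
    by (auto simp: quot_proj_def Equiv_Relations.proj_def)
  ultimately show ?thesis
    unfolding quot_scale_def by blast
qed

end

theory Submission
  imports Defs "HOL-Computational_Algebra.Fundamental_Theorem_Algebra"
begin

text \<open>Let \<open>G = {r(D) f}\<close> be the cyclic module generated by \<open>f\<close>; it lies in every trial space
  \<open>F\<close>, and \<open>f, D f, \<dots>, D\<^sup>n\<^sup>-\<^sup>1 f\<close> with \<open>n = deg q\<close> is a basis of it. Since \<open>p(D)\<close> is injective
  on \<open>G\<close>, the function \<open>p(D) f\<close> has the same minimal annihilator \<open>q\<close>, so the module that it
  generates also has dimension \<open>n\<close> and equals \<open>G\<close>; that is, \<open>p(D)\<close> maps \<open>G\<close> onto \<open>G\<close>.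
  Thus \<open>G\<close> is itself a trial space, and minimality gives \<open>F = G\<close>. As \<open>dim ker q(D) \<le> n\<close>, even
  \<open>F = ker q(D)\<close>. If \<open>p(D) q(D) g = 0\<close>, then \<open>p(D) g \<in> ker q(D) = F = p(D) F\<close>, whence
  \<open>ker p(D) q(D) = F \<oplus> ker p(D)\<close>.\<close>

section \<open>Differentiation on the space of smooth functions\<close>

lemma Cinf_has_vector_derivative:
  assumes "f \<in> Cinf" shows "(f has_vector_derivative Dop f x) (at x)"
proof -
  have "(Dop ^^ 0) f differentiable (at x)"
    using assms unfolding Cinf_def by blast
  then show ?thesis
    by (simp add: vector_derivative_works Dop_def)
qed

lemma Dop_Cinf:
  assumes "f \<in> Cinf" shows "Dop f \<in> Cinf"
proof -
  have "(Dop ^^ n) (Dop f) differentiable (at x)" for n x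
  proof -
    have "(Dop ^^ Suc n) f differentiable (at x)"
      using assms unfolding Cinf_def by blast
    then show ?thesis by (simp add: funpow_swap1)
  qed
  then show ?thesis by (simp add: Cinf_def)
qed

text \<open>\<open>vector_derivative\<close> is a total choice operator, guaranteed to be linear
  only where derivatives exist. Hence the linearity facts below carry \<open>Cinf\<close>
  hypotheses.\<close>

lemma Dop_add:
  assumes "f \<in> Cinf" "g \<in> Cinf" shows "Dop (f + g) = Dop f + Dop g"
proof
  fix x
  have "((\<lambda>x. f x + g x) has_vector_derivative (Dop f x + Dop g x)) (at x)"
    by (intro has_vector_derivative_add Cinf_has_vector_derivative assms)
  then show "Dop (f + g) x = (Dop f + Dop g) x"
    by (simp add: Dop_def plus_fun_def vector_derivative_at)
qed

lemma Dop_fscale: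
  assumes "f \<in> Cinf" shows "Dop (fscale c f) = fscale c (Dop f)"
proof
  fix x
  have "((\<lambda>x. c * f x) has_vector_derivative (c * Dop f x)) (at x)"
    by (intro has_vector_derivative_mult_right Cinf_has_vector_derivative assms)
  then show "Dop (fscale c f) x = fscale c (Dop f) x"
    by (simp add: Dop_def fscale_def vector_derivative_at)
qed

lemma Dop_0 [simp]: "Dop (\<lambda>x. 0) = (\<lambda>x. 0)"
  by (simp add: Dop_def)

lemma funpow_Dop_Cinf: "f \<in> Cinf \<Longrightarrow> (Dop ^^ n) f \<in> Cinf"
  by (induction n) (auto intro: Dop_Cinf)

lemma funpow_Dop_add:
  "f \<in> Cinf \<Longrightarrow> g \<in> Cinf \<Longrightarrow> (Dop ^^ n) (f + g) = (Dop ^^ n) f + (Dop ^^ n) g"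
  by (induction n) (auto simp: Dop_add funpow_Dop_Cinf)

lemma funpow_Dop_fscale:
  "f \<in> Cinf \<Longrightarrow> (Dop ^^ n) (fscale c f) = fscale c ((Dop ^^ n) f)"
  by (induction n) (auto simp: Dop_fscale funpow_Dop_Cinf)

lemma subspace_Cinf: "cfun.subspace Cinf"
proof (rule cfun.subspaceI)
  have z: "(Dop ^^ n) 0 = 0" for n
    by (induction n) auto
  show "0 \<in> Cinf"
    unfolding Cinf_def by (simp add: z) (simp add: zero_fun_def)
  show "f + g \<in> Cinf" if "f \<in> Cinf" "g \<in> Cinf" for f g
  proof -
    have "(Dop ^^ n) f differentiable (at x)" "(Dop ^^ n) g differentiable (at x)" for n x
      using that by (auto simp: Cinf_def)
    then have "(\<lambda>x. (Dop ^^ n) f x + (Dop ^^ n) g x) differentiable (at x)" for n x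
      by (intro differentiable_add)
    then show ?thesis
      using funpow_Dop_add[OF that] by (simp add: Cinf_def plus_fun_def)
  qed
  show "fscale c f \<in> Cinf" if "f \<in> Cinf" for c f
  proof -
    have "(Dop ^^ n) f differentiable (at x)" for n x
      using that by (auto simp: Cinf_def)
    then have "(\<lambda>x. c * (Dop ^^ n) f x) differentiable (at x)" for n x
      by (intro differentiable_mult) auto
    then show ?thesis
      using funpow_Dop_fscale[OF that] by (simp add: Cinf_def fscale_def)
  qed
qed

section \<open>The action of polynomials in D\<close>

text \<open>Padding with zero coefficients brings polynomials of different degrees to a common
  summation range, so that they can be compared coefficientwise.\<close>

lemma pD_altdef:
  assumes "degree p \<le> n"
  shows "pD p f = (\<Sum>i\<le>n. fscale (coeff p i) ((Dop ^^ i) f))"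
  unfolding pD_def
  by (rule sum.mono_neutral_left) (use assms in \<open>auto simp: coeff_eq_0 fscale_def fun_eq_iff\<close>)

lemma pD_0 [simp]: "pD 0 f = 0"
  by (simp add: pD_def)

lemma pD_pCons: "pD (pCons a p) f = fscale a f + pD p (Dop f)"
proof -
  have "pD (pCons a p) f = (\<Sum>i\<le>Suc (degree p). fscale (coeff (pCons a p) i) ((Dop ^^ i) f))"
    by (rule pD_altdef) (simp add: degree_pCons_le)
  also have "\<dots> = fscale a f + (\<Sum>i\<le>degree p. fscale (coeff p i) ((Dop ^^ i) (Dop f)))"
    by (subst sum.atMost_Suc_shift) (simp add: funpow_swap1)
  finally show ?thesis by (simp add: pD_def)
qed

lemma pD_add: "pD (p + q) f = pD p f + pD q f"
proof -
  define n where "n = max (degree p) (degree q)"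
  have "degree (p + q) \<le> n" "degree p \<le> n" "degree q \<le> n"
    using degree_add_le_max[of p q] by (auto simp: n_def)
  then show ?thesis
    by (simp add: pD_altdef[of _ n] cfun.scale_left_distrib sum.distrib)
qed

lemma pD_smult: "pD (smult c p) f = fscale c (pD p f)"
  using degree_smult_le[of c p]
  by (simp add: pD_altdef[of _ "degree p"] cfun.scale_sum_right)

lemma pD_Cinf: "f \<in> Cinf \<Longrightarrow> pD p f \<in> Cinf"
  unfolding pD_def
  by (intro cfun.subspace_sum cfun.subspace_scale subspace_Cinf funpow_Dop_Cinf)

lemma pD_fun_add: "f \<in> Cinf \<Longrightarrow> g \<in> Cinf \<Longrightarrow> pD p (f + g) = pD p f + pD p g"
  by (simp add: pD_def funpow_Dop_add cfun.scale_right_distrib sum.distrib)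

lemma pD_fun_fscale: "f \<in> Cinf \<Longrightarrow> pD p (fscale c f) = fscale c (pD p f)"
  by (simp add: pD_def funpow_Dop_fscale cfun.scale_sum_right mult.commute)

lemma pD_fun_zero [simp]: "pD p 0 = 0"
  using pD_fun_fscale[OF cfun.subspace_0[OF subspace_Cinf], of p 0] by simp

lemma pD_fun_diff: "f \<in> Cinf \<Longrightarrow> g \<in> Cinf \<Longrightarrow> pD p (f - g) = pD p f - pD p g"
  using pD_fun_add[of "f - g" g p] cfun.subspace_diff[OF subspace_Cinf, of f g] by simp

lemma pD_Dop: "f \<in> Cinf \<Longrightarrow> pD p (Dop f) = Dop (pD p f)"
proof (induction p arbitrary: f)
  case 0
  then show ?case by simp
next
  case (pCons a p)
  have "Dop (fscale a f + pD p (Dop f)) = Dop (fscale a f) + Dop (pD p (Dop f))"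
    using pCons.prems
    by (intro Dop_add pD_Cinf Dop_Cinf cfun.subspace_scale[OF subspace_Cinf])
  with pCons show ?case
    by (simp only: pD_pCons Dop_fscale Dop_Cinf)
qed

text \<open>This makes \<open>Cinf\<close> a module over the polynomial ring. Since that ring is
  commutative, any two operators \<open>pD p\<close> and \<open>pD q\<close> commute on
  \<open>Cinf\<close>, and this is how the fact is mostly used.\<close>

lemma pD_mult: "f \<in> Cinf \<Longrightarrow> pD (p * q) f = pD p (pD q f)"
  by (induction p arbitrary: f)
    (simp_all add: pD_add pD_smult pD_pCons pD_Dop Dop_Cinf pD_Cinf flip: pD_Dop)

lemma pD_const: "pD [:c:] f = fscale c f"
  by (simp add: pD_pCons)

lemma pD_monom: "pD (monom c n) f = fscale c ((Dop ^^ n) f)"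
  by (induction n arbitrary: f)
    (simp_all add: monom_0 monom_Suc pD_const pD_pCons funpow_swap1)

lemma pD_sum: "pD (\<Sum>i\<in>A. r i) f = (\<Sum>i\<in>A. pD (r i) f)"
  by (induction A rule: infinite_finite_induct) (auto simp: pD_add)

section \<open>Kernels and the upper bound for their dimension\<close>

lemma subspace_kerD: "cfun.subspace (kerD p)"
  by (rule cfun.subspaceI)
    (auto simp: kerD_def pD_fun_add pD_fun_fscale intro: cfun.subspace_0[OF subspace_Cinf]
       cfun.subspace_add[OF subspace_Cinf] cfun.subspace_scale[OF subspace_Cinf])

lemma kerD_dvd:
  assumes "p dvd q" shows "kerD p \<subseteq> kerD q"
proof -
  from assms obtain r where "q = r * p" by (metis dvd_def mult.commute)
  then show ?thesis by (auto simp: kerD_def pD_mult)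
qed

text \<open>Multiplying by the integrating factor \<open>exp (- a * x)\<close> turns a solution of
  \<open>h' = a h\<close> into a function with zero derivative, hence a constant.\<close>

lemma kerD_linear:
  assumes "h \<in> kerD [:- a, 1:]"
  shows "h \<in> cfun.span {\<lambda>x. exp (a * of_real x)}"
proof -
  have h: "h \<in> Cinf" and "pD [:- a, 1:] h = 0"
    using assms by (auto simp: kerD_def)
  then have eq: "Dop h x = a * h x" for x
    by (auto simp: pD_pCons fscale_def fun_eq_iff)
  have 0: "((\<lambda>x. exp (- a * of_real x)) has_vector_derivative
          exp (- a * of_real x) * (- a)) (at x)" for x :: real
    by (rule has_vector_derivative_real_field) (auto intro!: derivative_eq_intros)
  have "((\<lambda>x. h x * exp (- a * of_real x)) has_vector_derivative 0) (at x)" for x :: real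
    using has_vector_derivative_mult[OF Cinf_has_vector_derivative[OF h] 0, of x]
    by (simp add: eq algebra_simps)
  then obtain c where c: "h x * exp (- a * of_real x) = c" for x :: real
    using has_vector_derivative_zero_constant[of UNIV "\<lambda>x. h x * exp (- a * of_real x)"] by auto
  have "h x = c * exp (a * of_real x)" for x
    using c[of x] by (simp add: exp_minus field_simps)
  then have "h = fscale c (\<lambda>x. exp (a * of_real x))"
    by (auto simp: fscale_def)
  then show ?thesis
    by (metis cfun.span_base cfun.span_scale singletonI)
qed

text \<open>Induction on the degree, splitting off a root: if \<open>q = (D - a) r\<close>, then
  \<open>pD r\<close> maps \<open>kerD q\<close> into the line spanned by one exponential, so
  passing from \<open>kerD r\<close> to \<open>kerD q\<close> adds at most one dimension.\<close>

lemma kerD_finite_dim: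
  assumes "q \<noteq> 0"
  shows "\<exists>B. finite B \<and> card B \<le> degree q \<and> kerD q \<subseteq> cfun.span B"
  using assms
proof (induction "degree q" arbitrary: q)
  case 0
  \<comment> \<open>A nonzero constant acts injectively, so the empty set spans the kernel.\<close>
  then obtain c where "q = [:c:]" "c \<noteq> 0" by (metis degree_0_id pCons_0_0)
  then have "kerD q \<subseteq> cfun.span {}"
    by (auto simp: kerD_def pD_const)
  then show ?case by (metis card.empty finite.emptyI le0)
next
  case (Suc n)
  then have "\<not> constant (poly q)" by (simp add: constant_degree)
  then obtain a where "poly q a = 0" using fundamental_theorem_of_algebra by blast
  then obtain r where r: "q = [:- a, 1:] * r" by (auto simp: poly_eq_0_iff_dvd)
  with Suc.prems have r0: "r \<noteq> 0" by auto
  have "degree q = Suc (degree r)"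
    unfolding r using r0 by (subst degree_mult_eq) auto
  with Suc.hyps(2) have dr: "degree r = n" by simp
  have "\<exists>B. finite B \<and> card B \<le> degree r \<and> kerD r \<subseteq> cfun.span B"
    using Suc.hyps(1)[OF dr[symmetric] r0] .
  then obtain B where B: "finite B" "card B \<le> n" "kerD r \<subseteq> cfun.span B"
    unfolding dr by blast
  show ?case
  proof (cases "kerD q \<subseteq> kerD r")
    case True
    with B(3) have "kerD q \<subseteq> cfun.span B" by simp
    moreover have "card B \<le> degree q" using B(2) Suc.hyps(2) by simp
    ultimately show ?thesis using B(1) by blast
  next
    case False
    then obtain g where g: "g \<in> kerD q" "g \<notin> kerD r" by blast
    let ?e = "\<lambda>x. exp (a * of_real x) :: complex"
    have mult: "\<exists>c. pD r h = fscale c ?e" if "h \<in> kerD q" for h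
    proof -
      have "pD r h \<in> kerD [:- a, 1:]"
        using that pD_mult[of h "[:- a, 1:]" r, folded r] by (auto simp: kerD_def pD_Cinf)
      from kerD_linear[OF this] show ?thesis by (auto simp: cfun.span_singleton)
    qed
    from mult[OF g(1)] obtain c where c: "pD r g = fscale c ?e" ..
    have "c \<noteq> 0" using g c by (auto simp: kerD_def)
    have "h \<in> cfun.span (insert g B)" if h: "h \<in> kerD q" for h
    proof -
      from mult[OF h] obtain d where d: "pD r h = fscale d ?e" ..
      have C: "h \<in> Cinf" "g \<in> Cinf" using h g by (auto simp: kerD_def)
      \<comment> \<open>The factor \<open>d / c\<close> is chosen so that the two multiples of the
        exponential cancel under \<open>pD r\<close>.\<close>
      have "h - fscale (d / c) g \<in> kerD r"
        using C \<open>c \<noteq> 0\<close> by (simp add: kerD_def pD_fun_diff pD_fun_fscale c d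
            cfun.subspace_diff[OF subspace_Cinf] cfun.subspace_scale[OF subspace_Cinf])
      with B(3) show ?thesis by (auto simp: cfun.span_insert)
    qed
    moreover have "card (insert g B) \<le> degree q"
      using B(1,2) Suc.hyps(2) by (simp add: card_insert_if)
    ultimately show ?thesis using B(1) by blast
  qed
qed

text \<open>A vector of \<open>S\<close> outside the span of \<open>B\<close> would enlarge
  \<open>B\<close> to an independent set of more than \<open>card C\<close> vectors in the span of
  \<open>C\<close>. Below, this turns inclusions between spaces of equal dimension into
  equalities.\<close>

lemma subset_span_of_card_ge:
  assumes "cfun.independent B" "B \<subseteq> S" "finite C" "S \<subseteq> cfun.span C" "card C \<le> card B"
  shows "S \<subseteq> cfun.span B"
proof
  fix g assume "g \<in> S"
  have fB: "finite B" using cfun.independent_span_bound[of C B] assms by auto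
  show "g \<in> cfun.span B"
  proof (rule ccontr)
    assume g: "g \<notin> cfun.span B"
    then have "cfun.independent (insert g B)" and "g \<notin> B"
      using assms(1) by (auto simp: cfun.independent_insert intro: cfun.span_base)
    then show False
      using cfun.independent_span_bound[of C "insert g B"] assms \<open>g \<in> S\<close> fB by auto
  qed
qed

section \<open>The cyclic module generated by a function\<close>

definition cyclic_span :: "(real \<Rightarrow> complex) \<Rightarrow> (real \<Rightarrow> complex) set" where
  "cyclic_span f = range (\<lambda>r. pD r f)"

lemma pD_in_cyclic_span [simp]: "pD r f \<in> cyclic_span f"
  by (simp add: cyclic_span_def)

lemma self_in_cyclic_span: "f \<in> cyclic_span f"
  using pD_in_cyclic_span[of 1 f] by (simp add: pD_const one_pCons del: pD_in_cyclic_span)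

lemma subspace_cyclic_span: "cfun.subspace (cyclic_span f)"
proof (rule cfun.subspaceI)
  show "0 \<in> cyclic_span f" using pD_in_cyclic_span[of 0 f] by simp
qed (auto simp: cyclic_span_def pD_add[symmetric] pD_smult[symmetric])

lemma pD_invariant:
  assumes "cfun.subspace F" "Dop ` F \<subseteq> F" "f \<in> F"
  shows "pD p f \<in> F"
proof -
  have "(Dop ^^ i) f \<in> F" for i
    using assms(2,3) by (induction i) auto
  then show ?thesis
    unfolding pD_def by (intro cfun.subspace_sum cfun.subspace_scale assms(1))
qed

lemma pD_minimal_annihilator_eq_0:
  assumes "minimal_annihilator q f" "pD r f = 0" "degree r < degree q"
  shows "r = 0"
  using assms unfolding minimal_annihilator_def annihilator_def by (meson not_le)

text \<open>A linear relation among these derivatives is a polynomial of degree below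
  \<open>degree q\<close> that kills \<open>f\<close>, hence zero by minimality. Division by
  \<open>q\<close> with remainder gives spanning.\<close>

lemma cyclic_span_basis:
  assumes f: "f \<in> Cinf" and q: "minimal_annihilator q f"
  defines "B \<equiv> (\<lambda>i. (Dop ^^ i) f) ` {..<degree q}"
  shows "cfun.independent B" "card B = degree q" "cyclic_span f = cfun.span B"
proof -
  have q0: "q \<noteq> 0" "pD q f = 0"
    using q by (auto simp: minimal_annihilator_def annihilator_def)
  have Dpow: "(Dop ^^ i) f = pD (monom 1 i) f" for i
    by (simp add: pD_monom)
  \<comment> \<open>\<open>B\<close> is a set, so repeated derivatives would collapse. A repetition
    would make the difference of two monomials an operator of too small degree that kills
    \<open>f\<close>.\<close>
  have inj: "inj_on (\<lambda>i. (Dop ^^ i) f) {..<degree q}"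
  proof (rule inj_onI)
    fix i j assume ij: "i \<in> {..<degree q}" "j \<in> {..<degree q}"
      and eq: "(Dop ^^ i) f = (Dop ^^ j) f"
    have "pD (monom 1 i + smult (-1) (monom 1 j)) f = 0"
      using eq by (simp only: pD_add pD_smult Dpow) simp
    moreover have "degree (monom 1 i + smult (-1) (monom 1 j) :: complex poly) < degree q"
      using ij by (intro degree_add_less) (auto simp: degree_monom_eq)
    ultimately have "monom 1 i + smult (-1) (monom 1 j) = (0 :: complex poly)"
      using pD_minimal_annihilator_eq_0[OF q] by blast
    then have "coeff (monom 1 i + smult (-1) (monom 1 j) :: complex poly) i = 0" by simp
    then show "i = j" by (simp split: if_splits)
  qed
  then show "card B = degree q" by (simp add: B_def card_image)
  have "\<not> cfun.dependent B"
  proof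
    assume "cfun.dependent B"
    then obtain u v where u: "(\<Sum>v\<in>B. fscale (u v) v) = 0" and v: "v \<in> B" "u v \<noteq> 0"
      by (auto simp: cfun.dependent_finite B_def)
    define r where "r = (\<Sum>i<degree q. monom (u ((Dop ^^ i) f)) i)"
    have "pD r f = 0"
      using u by (simp add: r_def pD_sum pD_monom B_def sum.reindex[OF inj])
    moreover obtain j where j: "j < degree q" "v = (Dop ^^ j) f"
      using v by (auto simp: B_def)
    have "degree r < degree q"
      unfolding r_def
      using j(1) by (intro degree_sum_less) (auto intro: le_less_trans[OF degree_monom_le])
    ultimately have "r = 0" using pD_minimal_annihilator_eq_0[OF q] by blast
    moreover have "coeff r j = u v"
      using j by (simp add: r_def coeff_sum)
    ultimately show False using v by simp
  qed
  then show "cfun.independent B" .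
  have "pD r f \<in> cfun.span B" for r
  proof -
    have "pD r f = pD (r div q * q + r mod q) f" by simp
    also have "\<dots> = pD (r mod q) f"
      using f q0 by (simp only: pD_add pD_mult pD_fun_zero) simp
    finally have "pD r f = pD (r mod q) f" .
    also have "\<dots> \<in> cfun.span B"
    \<comment> \<open>If \<open>q\<close> is a nonzero constant, the remainder is zero and its
      degree 0 is not below \<open>degree q\<close>; the set \<open>B\<close> is then empty.\<close>
    proof (cases "r mod q = 0")
      case True
      then show ?thesis by (simp add: cfun.span_zero)
    next
      case False
      then have "degree (r mod q) < degree q" using q0 degree_mod_less by blast
      then show ?thesis unfolding pD_def
        by (intro cfun.span_sum cfun.span_scale cfun.span_base) (auto simp: B_def)
    qed
    finally show ?thesis .
  qed
  moreover have "B \<subseteq> cyclic_span f" by (auto simp: B_def Dpow)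
  then have "cfun.span B \<subseteq> cyclic_span f"
    by (rule cfun.span_minimal) (rule subspace_cyclic_span)
  ultimately show "cyclic_span f = cfun.span B" by (auto simp: cyclic_span_def)
qed

lemma cyclic_span_subset_kerD:
  assumes "f \<in> Cinf" "minimal_annihilator q f"
  shows "cyclic_span f \<subseteq> kerD q"
proof -
  have "pD q (pD r f) = 0" for r
    using assms
    by (metis annihilator_def minimal_annihilator_def pD_mult mult.commute pD_fun_zero)
  then show ?thesis
    using assms(1) by (auto simp: cyclic_span_def kerD_def pD_Cinf)
qed

text \<open>The operators commute, so \<open>r\<close> kills \<open>pD p f\<close> iff
  \<open>pD p\<close> kills \<open>pD r f\<close>. The latter lies in the cyclic module, where
  \<open>pD p\<close> has trivial kernel; thus both functions have the same annihilators.\<close>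

lemma minimal_annihilator_pD:
  assumes f: "f \<in> Cinf" and q: "minimal_annihilator q f"
    and ker: "kerD p \<inter> cyclic_span f \<subseteq> {0}"
  shows "minimal_annihilator q (pD p f)"
proof -
  have comm: "pD r (pD p f) = pD p (pD r f)" for r
    using f by (metis pD_mult mult.commute)
  have "annihilator r (pD p f) \<longleftrightarrow> annihilator r f" for r
  proof -
    have "pD r f = 0" if "pD p (pD r f) = 0"
    proof -
      have "pD r f \<in> kerD p \<inter> cyclic_span f"
        using that f by (simp add: kerD_def pD_Cinf)
      with ker show ?thesis by blast
    qed
    then show ?thesis by (auto simp: annihilator_def comm)
  qed
  with q show ?thesis by (simp add: minimal_annihilator_def)
qed

section \<open>Trial spaces and the cyclic module\<close>

lemma trial_space_cyclic_span:
  assumes f: "f \<in> Cinf" and q: "minimal_annihilator q f" and F: "trial_space p f F"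
  shows "trial_space p f (cyclic_span f)" "cyclic_span f \<subseteq> F"
proof -
  have F': "cfun.subspace F" "F \<subseteq> Cinf" "f \<in> F" "Dop ` F \<subseteq> F" "bij_betw (pD p) F F"
      "kerD p \<inter> F = {0}"
    using F by (auto simp: trial_space_def fin_dim_subspace_def vs_iso_def)
  show sub: "cyclic_span f \<subseteq> F"
    using pD_invariant[OF F'(1,4,3)] by (auto simp: cyclic_span_def)
  have C: "cyclic_span f \<subseteq> Cinf" using sub F' by blast
  have ker: "kerD p \<inter> cyclic_span f = {0}"
  proof
    show "kerD p \<inter> cyclic_span f \<subseteq> {0}" using sub F'(6) by blast
    show "{0} \<subseteq> kerD p \<inter> cyclic_span f"
      using cfun.subspace_0[OF subspace_cyclic_span] cfun.subspace_0[OF subspace_kerD] by simp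
  qed
  have pf: "pD p f \<in> Cinf" and qpf: "minimal_annihilator q (pD p f)"
    using f minimal_annihilator_pD[OF f q] ker by (simp_all add: pD_Cinf)
  have img: "pD p ` cyclic_span f = cyclic_span (pD p f)"
    unfolding cyclic_span_def image_image using f by (metis pD_mult mult.commute)
  have img_sub: "cyclic_span (pD p f) \<subseteq> cyclic_span f"
    using f by (auto simp: cyclic_span_def pD_mult[symmetric])
  obtain B' where B': "cfun.independent B'" "card B' = degree q"
      "cyclic_span (pD p f) = cfun.span B'"
    using cyclic_span_basis[OF pf qpf] by blast
  obtain E where E: "finite E" "card E \<le> degree q" "kerD q \<subseteq> cfun.span E"
    using kerD_finite_dim q unfolding minimal_annihilator_def annihilator_def by meson
  have "B' \<subseteq> cyclic_span f"
    using img_sub B'(3) cfun.span_superset by blast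
  \<comment> \<open>Both modules lie in \<open>kerD q\<close>, which is spanned by at most
    \<open>degree q\<close> vectors, and \<open>B'\<close> already has that many independent
    ones.\<close>
  then have surj: "cyclic_span f \<subseteq> cyclic_span (pD p f)"
    using subset_span_of_card_ge[of B' "cyclic_span f" E] cyclic_span_subset_kerD[OF f q] B' E
    by auto
  have "bij_betw (pD p) (cyclic_span f) (cyclic_span f)"
    unfolding bij_betw_def
  proof
    show "inj_on (pD p) (cyclic_span f)"
      using F'(5) sub by (auto simp: bij_betw_def intro: inj_on_subset)
    show "pD p ` cyclic_span f = cyclic_span f"
      using img img_sub surj by simp
  qed
  moreover have "Dop ` cyclic_span f \<subseteq> cyclic_span f"
    using f by (auto simp: cyclic_span_def pD_Dop[symmetric] pD_pCons[of 0, simplified, symmetric])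
  moreover have "\<exists>B. finite B \<and> cyclic_span f = cfun.span B"
    using cyclic_span_basis(3)[OF f q] by blast
  ultimately show "trial_space p f (cyclic_span f)"
    using C ker subspace_cyclic_span self_in_cyclic_span
    by (auto simp: trial_space_def fin_dim_subspace_def vs_iso_def pD_fun_add pD_fun_fscale
        subset_iff)
qed

lemma minimal_trial_space_eq_kerD:
  assumes f: "f \<in> Cinf" and q: "minimal_annihilator q f" and F: "minimal_trial_space p f F"
  shows "F = kerD q" "cfun.dim F = degree q"
proof -
  obtain B where B: "cfun.independent B" "card B = degree q" "cyclic_span f = cfun.span B"
    using cyclic_span_basis[OF f q] by blast
  have tF: "trial_space p f F" using F by (simp add: minimal_trial_space_def)
  note G = trial_space_cyclic_span[OF f q tF]
  have dimG: "cfun.dim (cyclic_span f) = degree q"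
    using B cfun.dim_span_eq_card_independent by metis
  obtain C where C: "C \<subseteq> F" "cfun.independent C" "F \<subseteq> cfun.span C" "card C = cfun.dim F"
    using cfun.basis_exists by blast
  have "finite C"
    using tF C cfun.independent_span_bound[of _ C]
    by (auto simp: trial_space_def fin_dim_subspace_def)
  moreover have "cfun.dim F \<le> degree q"
    using F G(1) dimG by (metis minimal_trial_space_def)
  moreover have "B \<subseteq> F" using B G(2) by (metis cfun.span_superset order_trans)
  \<comment> \<open>The basis \<open>B\<close> of the cyclic module has \<open>degree q\<close>
    elements, at least as many as the basis \<open>C\<close> of \<open>F\<close>.\<close>
  ultimately have "F \<subseteq> cyclic_span f"
    using subset_span_of_card_ge[of B F C] B C by simp
  with G have FG: "F = cyclic_span f" by blast
  with dimG show "cfun.dim F = degree q" by simp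
  have q0: "q \<noteq> 0"
    using q by (auto simp: minimal_annihilator_def annihilator_def)
  have sub: "F \<subseteq> kerD q"
    unfolding FG by (rule cyclic_span_subset_kerD[OF f q])
  obtain E where "finite E" "card E \<le> degree q" "kerD q \<subseteq> cfun.span E"
    using kerD_finite_dim[OF q0] by blast
  \<comment> \<open>The same count with \<open>E\<close> in place of \<open>C\<close> shows that
    \<open>B\<close> already spans the whole kernel.\<close>
  then have "kerD q \<subseteq> cfun.span B"
    using subset_span_of_card_ge[of B "kerD q" E] B \<open>B \<subseteq> F\<close> sub by auto
  with sub show "F = kerD q" using FG B by blast
qed

theorem theorem4p8:
  fixes p q :: "complex poly" and f :: "real \<Rightarrow> complex" and F :: "(real \<Rightarrow> complex) set"
  assumes "f \<in> M_tors"
    and "minimal_annihilator q f"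
    and "minimal_trial_space p f F"
  shows "F \<subseteq> kerD (p * q) \<and>
    vs_iso (+) fscale F
      (quot_add (kerD (p * q)) (kerD p)) (quot_scale (kerD (p * q)) (kerD p))
      (quot_space (kerD (p * q)) (kerD p))
      (quot_proj (kerD (p * q)) (kerD p)) \<and>
    cfun.dim F = degree q"
proof (intro conjI)
  let ?U = "kerD (p * q)" and ?W = "kerD p"
  let ?pi = "quot_proj ?U ?W"
  have f: "f \<in> Cinf" using assms(1) by (simp add: M_tors_def)
  note Fq = minimal_trial_space_eq_kerD[OF f assms(2,3)]
  show sub: "F \<subseteq> ?U" unfolding Fq(1) by (rule kerD_dvd) simp
  have F: "cfun.subspace F" "F \<subseteq> Cinf" "pD p ` F = F" "?W \<inter> F = {0}"
    using assms(3) by (auto simp: minimal_trial_space_def trial_space_def fin_dim_subspace_def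
        vs_iso_def bij_betw_def)
  note proj_eq = quot_proj_eq_iff[OF subspace_kerD, of _ ?U _ p]
  have "inj_on ?pi F"
  proof (rule inj_onI)
    fix g h assume "g \<in> F" "h \<in> F" "?pi g = ?pi h"
    then have "g - h \<in> ?W \<inter> F"
      using proj_eq[of g h] sub cfun.subspace_diff[OF F(1)] by auto
    then show "g = h" using F(4) by auto
  qed
  moreover have "?pi ` F = quot_space ?U ?W"
  proof
    show "?pi ` F \<subseteq> quot_space ?U ?W"
      using sub by (auto simp: quot_space_def quot_proj_def proj_preserves)
    show "quot_space ?U ?W \<subseteq> ?pi ` F"
    proof
      fix A assume "A \<in> quot_space ?U ?W"
      then obtain g where g: "g \<in> ?U" "A = ?pi g"
        by (auto simp: quot_space_def quot_proj_def quotient_def Equiv_Relations.proj_def)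
      then have gC: "g \<in> Cinf" and "pD p g \<in> kerD q"
        by (auto simp: kerD_def pD_Cinf pD_mult[symmetric] mult.commute)
      \<comment> \<open>Since \<open>kerD q\<close> is \<open>F\<close>, on which
        \<open>pD p\<close> is onto, the coset of \<open>g\<close> acquires a representative
        \<open>h\<close> in \<open>F\<close>.\<close>
      then have "pD p g \<in> pD p ` F" using F(3) Fq(1) by simp
      then obtain h where h: "h \<in> F" "pD p g = pD p h" by auto
      then have "g - h \<in> ?W"
        using gC F(2) by (auto simp: kerD_def pD_fun_diff cfun.subspace_diff[OF subspace_Cinf])
      then have "?pi g = ?pi h" using proj_eq[of g h] g h sub by auto
      with g h show "A \<in> ?pi ` F" by blast
    qed
  qed
  ultimately show "vs_iso (+) fscale F (quot_add ?U ?W) (quot_scale ?U ?W) (quot_space ?U ?W) ?pi"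
    using sub quot_add_proj[OF subspace_kerD subspace_kerD]
      quot_scale_proj[OF subspace_kerD subspace_kerD]
    by (auto simp: vs_iso_def bij_betw_def subset_iff)
  show "cfun.dim F = degree q" by (fact Fq(2))
qed

end
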